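(* For every irrational $\gamma\in(0,1/2)$, the map $Q_\gamma:\mathbb N_0\to\mathbb N_0$ defined by $Q_\gamma(0)=0$ and $$Q_\gamma(k)=\lfloor k\omega_\gamma\rfloor-\lfloor(k-1)\omega_\gamma\rfloor\quad(k\ge1),\qquad \omega_\gamma=\frac{\gamma}{1-\gamma},$$ is an admissible kneading map.
   Context: $\mathbb N$ is the set of positive integers and $\mathbb N_0=\mathbb N\cup\{0\}$; $[a,b]$ denotes the closed interval with endpoints $a,b$ in either order. Unimodal map: a continuous noninjective map $f:I\to I$ of a compact interval $I$ with $f(\partial I)\subset\partial I$, having a unique turning point $c\in\mathrm{int}(I)$, which is a maximum: $f$ is strictly increasing to the left of $c$ and strictly decreasing to the right. Write $c_n=f^n(c)$; standing normalization $c_2<c<c_1$, $c_2<c_3$. Let $D_1=[c,c_1]$ and, for $n\ge2$, $D_n=f(D_{n-1})$ if $c\notin D_{n-1}$, $D_n=[c_n,c_1]$ if $c\in D_{n-1}$. The cutting times $1=S_0<S_1<\cdots$ are the $n\ge1$ with $c\in D_n$, and the kneading map $Q$ of $f$ is defined by $S_k-S_{k-1}=S_{Q(k)}$ for $k\ge1$, extended by $Q(0)=0$. A map $Q:\mathbb N_0\to\mathbb N_0$ with $Q(0)=0$ is an admissible kneading map if it is the kneading map of some unimodal map with nonperiodic turning point. By the known Hofbauer--Bruin criterion, this is equivalent to: $Q(k)\le k-1$ and $(Q(k+j))_{j\ge1}\succeq_{\mathrm{lex}}(Q(Q^2(k)+j))_{j\ge1}$ for every $k\ge1$, where $Q^2=Q\circ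 Q$ and $\succeq_{\rm lex}$ is the lexicographic order. *)

theory Defs
  imports "HOL-Analysis.Analysis" "HOL-Library.Infinite_Set"
begin

definition unimodal_map :: "real \<Rightarrow> real \<Rightarrow> real \<Rightarrow> (real \<Rightarrow> real) \<Rightarrow> bool" where
  "unimodal_map a b c f \<longleftrightarrow>
     a < b \<and> f ` {a..b} \<subseteq> {a..b} \<and> continuous_on {a..b} f \<and> \<not> inj_on f {a..b} \<and>
     f ` {a, b} \<subseteq> {a, b} \<and>
     c \<in> {a<..<b} \<and> strict_mono_on {a..c} f \<and> strict_antimono_on {c..b} f"

definition normalized_at :: "(real \<Rightarrow> real) \<Rightarrow> real \<Rightarrow> bool" where
  "normalized_at f c \<longleftrightarrow>
     (f ^^ 2) c < c \<and> c < (f ^^ 1) c \<and> (f ^^ 2) c < (f ^^ 3) c"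

definition nonperiodic_point :: "(real \<Rightarrow> real) \<Rightarrow> real \<Rightarrow> bool" where
  "nonperiodic_point f c \<longleftrightarrow> (\<forall>n\<ge>1. (f ^^ n) c \<noteq> c)"

(* D_n is meaningful for n >= 1 only; the value at 0 is a dummy. *)
fun D_interval :: "(real \<Rightarrow> real) \<Rightarrow> real \<Rightarrow> nat \<Rightarrow> real set" where
  "D_interval f c 0 = {}"
| "D_interval f c (Suc 0) = closed_segment c (f c)"
| "D_interval f c (Suc (Suc n)) =
     (if c \<in> D_interval f c (Suc n)
      then closed_segment ((f ^^ Suc (Suc n)) c) (f c)
      else f ` D_interval f c (Suc n))"

definition cutting_times :: "(real \<Rightarrow> real) \<Rightarrow> real \<Rightarrow> nat set" where
  "cutting_times f c = {n. 1 \<le> n \<and> c \<in> D_interval f c n}"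

(* The increasing enumeration S_0 < S_1 < ...; it is meaningful for all k only
   when there are infinitely many cutting times. *)
definition cutting_time :: "(real \<Rightarrow> real) \<Rightarrow> real \<Rightarrow> nat \<Rightarrow> nat" where
  "cutting_time f c = enumerate (cutting_times f c)"

lemma cutting_time_0: "cutting_time f c 0 = 1"
  unfolding cutting_time_def cutting_times_def enumerate_0
  by (rule Least_equality) auto

(* A relation rather than a function: a map with only finitely many cutting times
   has no kneading map with values in the natural numbers.  Since the cutting times
   increase strictly, at most one Q is related to a given f and c. *)
definition is_kneading_map_of :: "(nat \<Rightarrow> nat) \<Rightarrow> (real \<Rightarrow> real) \<Rightarrow> real \<Rightarrow> bool" where
  "is_kneading_map_of Q f c \<longleftrightarrow>
     infinite (cutting_times f c) \<and> Q 0 = 0 \<and>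
     (\<forall>k\<ge>1. cutting_time f c k - cutting_time f c (k - 1) = cutting_time f c (Q k))"

definition admissible_kneading_map :: "(nat \<Rightarrow> nat) \<Rightarrow> bool" where
  "admissible_kneading_map Q \<longleftrightarrow> Q 0 = 0 \<and>
     (\<exists>a b c f. unimodal_map a b c f \<and> normalized_at f c \<and> nonperiodic_point f c \<and>
                is_kneading_map_of Q f c)"

definition omega :: "real \<Rightarrow> real" where
  "omega \<gamma> = \<gamma> / (1 - \<gamma>)"

definition Q_rot :: "real \<Rightarrow> nat \<Rightarrow> nat" where
  "Q_rot \<gamma> k =
     (if k = 0 then 0 else nat (\<lfloor>real k * omega \<gamma>\<rfloor> - \<lfloor>(real k - 1) * omega \<gamma>\<rfloor>))"

(* No truncation takes place in the definition above for the parameters of interest. *)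
lemma int_Q_rot:
  assumes "0 < \<gamma>" "\<gamma> < 1/2" "k \<ge> 1"
  shows "int (Q_rot \<gamma> k) = \<lfloor>real k * omega \<gamma>\<rfloor> - \<lfloor>(real k - 1) * omega \<gamma>\<rfloor>"
proof -
  have "omega \<gamma> \<ge> 0" using assms by (simp add: omega_def)
  then have "(real k - 1) * omega \<gamma> \<le> real k * omega \<gamma>" by (intro mult_right_mono) auto
  then have "\<lfloor>(real k - 1) * omega \<gamma>\<rfloor> \<le> \<lfloor>real k * omega \<gamma>\<rfloor>" by (rule floor_mono)
  then show ?thesis using assms by (simp add: Q_rot_def)
qed

end

theory Submission imports Defs begin

text \<open>
  Write \<open>\<omega>\<close> for the slope.  A kneading map with values in \<open>{0, 1}\<close> cuts the itinerary of the
  turning point into blocks \<open>0\<close> (if \<open>Q k = 0\<close>) and \<open>11\<close> (if \<open>Q k = 1\<close>).  Both preserve orientation,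
  so the points \<open>z k\<close> of the critical orbit at which the blocks start are ordered like the
  shifts of \<open>Q\<close>, which for a Sturmian \<open>Q\<close> means like the points \<open>frac (k * \<omega>)\<close> of a rotation orbit.
  Blow up the backward orbit \<open>frac (- n * \<omega>)\<close>, \<open>n \<ge> 1\<close>, of the discontinuity of the rotation to
  gaps of length \<open>2 ^ (- n)\<close> and give the rest of the circle length zero.  Then the rotation becomes
  \<open>x \<mapsto> 2 * x + z 1 - 2 * Q\<close>, and flipping its upper branch by \<open>x \<mapsto> 2 - x\<close> yields an explicit
  piecewise linear unimodal map, whose turning point is the upper end of the first gap.
\<close>

lemma enumerate_range_strict_mono:
  fixes s :: "nat \<Rightarrow> nat"
  assumes "strict_mono s"
  shows "enumerate (range s) = s"
proof
  fix n
  have inf: "infinite (range s)"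
    using assms by (intro range_inj_infinite strict_mono_imp_inj_on)
  show "enumerate (range s) n = s n"
  proof (induction n)
    case 0
    show ?case
      unfolding enumerate_0 using assms
      by (intro Least_equality) (auto simp: strict_mono_less_eq)
  next
    case (Suc n)
    show ?case
      unfolding enumerate_Suc''[OF inf] Suc using assms
      by (intro Least_equality) (auto simp: strict_mono_less strict_mono_less_eq)
  qed
qed

locale irrational_slope =
  fixes \<omega> :: real
  assumes irrational: "\<omega> \<notin> \<rat>" and pos: "0 < \<omega>" and less_1: "\<omega> < 1"
begin

lemma floor_slope [simp]: "\<lfloor>\<omega>\<rfloor> = 0"
  using pos less_1 by (simp add: floor_eq_iff)

section \<open>Carries of the floor function and their dyadic series\<close>

definition carry :: "nat \<Rightarrow> nat \<Rightarrow> int" where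
  "carry k n = \<lfloor>real (k + n) * \<omega>\<rfloor> - \<lfloor>real k * \<omega>\<rfloor> - \<lfloor>real n * \<omega>\<rfloor>"

lemma carry_cases: "carry k n = 0 \<or> carry k n = 1"
proof -
  have "real (k + n) * \<omega> = real k * \<omega> + real n * \<omega>"
    by (simp add: distrib_right)
  then show ?thesis
    unfolding carry_def by linarith
qed

text \<open>Cocycle identity of a coboundary; summed over \<open>n\<close> it becomes the recursion
  for \<open>z\<close>.\<close>

lemma carry_Suc: "carry (Suc k) n = carry k (Suc n) + carry 1 n - carry k 1"
  by (simp add: carry_def)

text \<open>Without carries, \<open>frac (m * k * \<omega>)\<close> would be
  \<open>m * frac (k * \<omega>)\<close>, which exceeds 1 for large \<open>m\<close> since
  \<open>frac (k * \<omega>) > 0\<close> by irrationality.\<close>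

lemma carry_ex:
  assumes "0 < k"
  shows "\<exists>n\<ge>1. carry k n = 1"
proof (rule ccontr)
  assume "\<not> ?thesis"
  then have no_carry: "carry k n = 0" if "n \<ge> 1" for n
    using carry_cases that by blast
  have mult: "\<lfloor>real (Suc m * k) * \<omega>\<rfloor> = int (Suc m) * \<lfloor>real k * \<omega>\<rfloor>" for m
  proof (induction m)
    case (Suc m)
    have "carry k (Suc m * k) = 0"
      using assms by (intro no_carry) simp
    then have "\<lfloor>real (k + Suc m * k) * \<omega>\<rfloor> = \<lfloor>real k * \<omega>\<rfloor> + \<lfloor>real (Suc m * k) * \<omega>\<rfloor>"
      by (simp add: carry_def)
    then show ?case
      unfolding Suc.IH by (simp add: algebra_simps)
  qed simp
  have "real k * \<omega> \<notin> \<int>"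
  proof
    assume "real k * \<omega> \<in> \<int>"
    then have "real k * \<omega> / real k \<in> \<rat>"
      using Ints_subset_Rats by (intro Rats_divide) auto
    with irrational assms show False by simp
  qed
  then have "frac (real k * \<omega>) > 0"
    by simp
  then obtain m where m: "1 < real m * frac (real k * \<omega>)"
    using reals_Archimedean3 by blast
  then obtain m' where m': "m = Suc m'"
    by (cases m) auto
  have "real m * frac (real k * \<omega>) = real (m * k) * \<omega> - \<lfloor>real (m * k) * \<omega>\<rfloor>"
    unfolding m' mult by (simp add: frac_def algebra_simps)
  also have "\<dots> < 1" by linarith
  finally show False using m by simp
qed

text \<open>
  For \<open>n \<ge> 1\<close> there is a carry iff \<open>frac (- n * \<omega>) \<le> frac (k * \<omega>)\<close>, so that \<open>z k\<close> is the total length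
  of the gaps up to \<open>frac (k * \<omega>)\<close>.
\<close>

definition z :: "nat \<Rightarrow> real" where
  "z k = (\<Sum>n. carry k (Suc n) / 2 ^ Suc n)"

lemma power_half_series: "(\<lambda>n. 1 / 2 ^ Suc n :: real) sums 1"
  using power_half_series by (simp add: power_one_over)

lemma summable_carry: "summable (\<lambda>n. carry k (Suc n) / 2 ^ Suc n :: real)"
proof (rule summable_comparison_test')
  show "summable (\<lambda>n. 1 / 2 ^ Suc n :: real)"
    using power_half_series by (rule sums_summable)
  show "norm (carry k (Suc n) / 2 ^ Suc n :: real) \<le> 1 / 2 ^ Suc n" for n
    using carry_cases[of k "Suc n"] by auto
qed

lemma z_0 [simp]: "z 0 = 0"
  by (simp add: z_def carry_def)

lemma z_le_1: "z k \<le> 1"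
proof -
  have "z k \<le> (\<Sum>n. 1 / 2 ^ Suc n)"
    unfolding z_def
  proof (rule suminf_le[OF _ summable_carry])
    show "carry k (Suc n) / 2 ^ Suc n \<le> (1 / 2 ^ Suc n :: real)" for n
      using carry_cases[of k "Suc n"] by auto
  qed (rule sums_summable[OF power_half_series])
  then show ?thesis
    using sums_unique[OF power_half_series] by simp
qed

lemma z_pos:
  assumes "0 < k"
  shows "0 < z k"
proof -
  obtain n where n: "n \<ge> 1" "carry k n = 1"
    using carry_ex assms by blast
  then obtain i where "carry k (Suc i) = 1"
    by (cases n) auto
  then have "0 < (carry k (Suc i) / 2 ^ Suc i :: real)"
    by simp
  moreover have "0 \<le> (carry k (Suc n) / 2 ^ Suc n :: real)" for n
    using carry_cases[of k "Suc n"] by auto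
  ultimately show ?thesis
    unfolding z_def by (intro suminf_pos2[OF summable_carry])
qed

lemma z_nonneg: "0 \<le> z k"
  using z_pos[of k] by (cases k) auto

text \<open>Sum \<open>carry_Suc\<close> termwise: shifting the index doubles the series and loses
  its first term, \<open>carry k 1 / 2\<close>; the constant term costs another
  \<open>carry k 1\<close>.\<close>

lemma z_Suc: "z (Suc k) = 2 * z k + z 1 - 2 * carry k 1"
proof -
  let ?t = "\<lambda>k n. carry k (Suc n) / 2 ^ Suc n :: real"
  have sums: "?t k sums z k" for k
    unfolding z_def by (rule summable_sums[OF summable_carry])
  have "(\<lambda>n. ?t k (Suc n)) sums (z k - ?t k 0)"
    using sums_Suc_iff[of "?t k" "z k - ?t k 0"] sums[of k] by simp
  then have "(\<lambda>n. 2 * ?t k (Suc n) + ?t 1 n - carry k 1 * (1 / 2 ^ Suc n))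
      sums (2 * (z k - ?t k 0) + z 1 - real_of_int (carry k 1) * 1)"
    by (intro sums_diff sums_add sums_mult sums power_half_series)
  moreover have "2 * ?t k (Suc n) + ?t 1 n - carry k 1 * (1 / 2 ^ Suc n) = ?t (Suc k) n" for n
    by (simp add: carry_Suc[of k "Suc n"] field_simps)
  ultimately show ?thesis
    using sums_unique2[OF sums[of "Suc k"]] by simp
qed

section \<open>The unimodal map\<close>

definition c :: real where
  "c = 1 - z 1 / 2"

text \<open>The middle piece is the flipped upper branch; the piece \<open>2 - x\<close> undoes the
  flip one step later.\<close>

definition f :: "real \<Rightarrow> real" where
  "f x = min (2 * x + z 1) (max (4 - z 1 - 2 * x) (2 - x))"

lemma f_left: "x \<le> c \<Longrightarrow> f x = 2 * x + z 1"
  and f_middle: "c \<le> x \<Longrightarrow> x \<le> 2 - z 1 \<Longrightarrow> f x = 4 - z 1 - 2 * x"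
  and f_right: "2 - z 1 \<le> x \<Longrightarrow> f x = 2 - x"
  using z_nonneg[of 1] z_le_1[of 1] by (auto simp: f_def c_def)

lemma continuous_f: "continuous_on A f"
  unfolding f_def by (intro continuous_intros)

lemma c_bounds: "1 / 2 \<le> c" "c < 1"
  using z_pos[of 1] z_le_1[of 1] by (auto simp: c_def)

lemma unimodal_f: "unimodal_map (- z 1) (2 + z 1) c f"
proof -
  have less: "- z 1 < c" "c < 2 + z 1"
    using c_bounds z_pos[of 1] by auto
  have c_def': "z 1 = 2 - 2 * c"
    by (simp add: c_def)
  \<comment> \<open>The left end is the fixed point of \<open>2 * x + z 1\<close>, the right end its
    preimage under \<open>2 - x\<close>.\<close>
  have ends: "f (- z 1) = - z 1" "f (2 + z 1) = - z 1"
    using z_pos[of 1] by (auto simp: f_def)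
  have "strict_mono_on {- z 1..c} f"
    by (auto simp: monotone_on_def f_left)
  moreover have "f x = max (4 - z 1 - 2 * x) (2 - x)" if "c \<le> x" for x
    using that c_bounds unfolding f_def c_def' by (auto simp: min_def max_def)
  then have "strict_antimono_on {c..2 + z 1} f"
    by (auto simp: monotone_on_def)
  moreover have "f ` {- z 1..2 + z 1} \<subseteq> {- z 1..2 + z 1}"
    using z_pos[of 1] z_le_1[of 1] by (auto simp: f_def min_def max_def)
  moreover have "\<not> inj_on f {- z 1..2 + z 1}"
    using ends less inj_onD[of f _ "- z 1" "2 + z 1"] by force
  ultimately show ?thesis
    using ends less continuous_f by (simp add: unimodal_map_def)
qed

section \<open>The orbit of the turning point\<close>

definition S :: "nat \<Rightarrow> nat" where
  "S k = Suc (k + nat \<lfloor>real k * \<omega>\<rfloor>)"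

lemma S_0 [simp]: "S 0 = 1"
  by (simp add: S_def)

lemma int_S: "int (S k) = 1 + int k + \<lfloor>real k * \<omega>\<rfloor>"
  using pos by (simp add: S_def)

lemma S_Suc: "int (S (Suc k)) = int (S k) + 1 + carry k 1"
  by (simp add: int_S carry_def)

lemma S_Suc_if: "S (Suc k) = (if carry k 1 = 0 then Suc (S k) else Suc (Suc (S k)))"
  using S_Suc[of k] carry_cases[of k 1] by auto

lemma strict_mono_S: "strict_mono S"
  by (simp add: strict_mono_Suc_iff S_Suc_if)

lemma z_less_c: "carry k 1 = 0 \<Longrightarrow> z k < c"
  using z_Suc[of k] z_le_1[of "Suc k"] by (simp add: c_def)

text \<open>Strict because \<open>z (Suc k) > 0\<close>; this is how irrationality keeps the orbit
  off \<open>c\<close>.\<close>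

lemma z_greater_c: "carry k 1 \<noteq> 0 \<Longrightarrow> c < z k"
  using z_Suc[of k] z_pos[of "Suc k"] carry_cases[of k 1] by (simp add: c_def)

lemma f_z: "carry k 1 = 0 \<Longrightarrow> f (z k) = z (Suc k)"
  using z_less_c[of k] z_Suc[of k] by (simp add: f_left)

lemma f_z': "carry k 1 \<noteq> 0 \<Longrightarrow> f (z k) = 2 - z (Suc k)"
  using z_greater_c[of k] z_Suc[of k] carry_cases[of k 1] z_le_1[of k] z_le_1[of 1]
  by (simp add: f_middle)

text \<open>A carry forces \<open>z (Suc k) \<le> z 1\<close>, so the reflected point lies on the
  piece \<open>2 - x\<close>.\<close>

lemma f_reflected_z: "carry k 1 \<noteq> 0 \<Longrightarrow> f (2 - z (Suc k)) = z (Suc k)"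
  using z_Suc[of k] carry_cases[of k 1] z_le_1[of k] by (simp add: f_right)

lemma f_c: "f c = 2"
  by (simp add: f_left c_def)

lemma f_2: "f 2 = 0"
  using z_nonneg[of 1] by (simp add: f_right)

text \<open>Block \<open>k\<close> starts at time \<open>S k + 1\<close>, as the orbit begins
  \<open>c\<close>, 2, 0, and it takes one step without a carry, two with one.\<close>

lemma orbit_S: "(f ^^ Suc (S k)) c = z k"
proof (induction k)
  case 0
  then show ?case by (simp add: f_c f_2)
next
  case (Suc k)
  then show ?case
    by (cases "carry k 1 = 0") (simp_all add: S_Suc_if f_z f_z' f_reflected_z)
qed

lemma S_range_cases:
  assumes "1 \<le> n"
  obtains k where "n = S k" | k where "n = Suc (S k)" "carry k 1 \<noteq> 0"
proof -
  have "\<exists>k. n = S k \<or> n = Suc (S k) \<and> carry k 1 \<noteq> 0"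
    using assms
  proof (induction n rule: dec_induct)
    case base
    show ?case by (metis S_0)
  next
    case (step n)
    then show ?case by (metis S_Suc_if)
  qed
  then show ?thesis using that by blast
qed

lemma nonperiodic_c: "nonperiodic_point f c"
  unfolding nonperiodic_point_def
proof (intro allI impI)
  have z_neq: "z k \<noteq> c" for k
    using z_less_c[of k] z_greater_c[of k] by force
  fix n :: nat
  assume "1 \<le> n"
  show "(f ^^ n) c \<noteq> c"
  proof (cases "n = 1")
    case True
    then show ?thesis using c_bounds by (simp add: f_c)
  next
    case False
    with \<open>1 \<le> n\<close> obtain m where m: "n = Suc m" "1 \<le> m"
      by (cases n) auto
    from m(2) show ?thesis
    proof (cases rule: S_range_cases)
      case (1 k)
      then show ?thesis using z_neq m by (simp add: orbit_S del: funpow.simps)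
    next
      case (2 k)
      then have "(f ^^ n) c = 2 - z (Suc k)"
        using m orbit_S[of k] f_z'[of k] by simp
      then show ?thesis using z_le_1[of "Suc k"] c_bounds by simp
    qed
  qed
qed

lemma normalized_c: "normalized_at f c"
proof -
  have "f 0 = z 1"
    using c_bounds by (simp add: f_left)
  then show ?thesis
    using z_pos[of 1] c_bounds by (simp add: normalized_at_def numeral_eq_Suc f_c f_2)
qed

section \<open>Cutting times and the kneading map\<close>

lemma D_interval_step:
  assumes "1 \<le> n"
  shows "D_interval f c (Suc n) =
    (if c \<in> D_interval f c n then closed_segment ((f ^^ Suc n) c) 2 else f ` D_interval f c n)"
  using assms by (cases n) (auto simp: f_c)

lemma c_mem_segment: "c \<in> closed_segment (z k) 2 \<longleftrightarrow> carry k 1 = 0"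
  using z_le_1[of k] c_bounds z_less_c[of k] z_greater_c[of k]
  by (force simp: closed_segment_eq_real_ivl)

lemma S_ge_1: "1 \<le> S k"
  by (simp add: S_def)

lemma c_in_D_S: "c \<in> D_interval f c (S k)"
  and D_Suc_S: "D_interval f c (Suc (S k)) = closed_segment (z k) 2"
proof -
  \<comment> \<open>Stated conditionally because the induction for the first claim already uses
    it.\<close>
  have *: "D_interval f c (Suc (S k)) = closed_segment (z k) 2"
    if "c \<in> D_interval f c (S k)" for k
    using that D_interval_step[OF S_ge_1[of k]] orbit_S[of k] by simp
  show c: "c \<in> D_interval f c (S k)"
  proof (induction k)
    case 0
    then show ?case by simp
  next
    case (Suc k)
    note D = *[OF Suc]
    show ?case
    proof (cases "carry k 1 = 0")
      case True
      then show ?thesis by (simp add: S_Suc_if D c_mem_segment)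
    next
      case False
      \<comment> \<open>The segment misses \<open>c\<close>, but its image reaches from 0 to
        \<open>2 - z (Suc k) \<ge> 1\<close>, across \<open>c\<close>.\<close>
      have "c \<le> f (z k)" "f 2 \<le> c"
        using z_le_1[of "Suc k"] c_bounds False by (simp_all add: f_z' f_2)
      then obtain x where "z k \<le> x" "x \<le> 2" "f x = c"
        using z_le_1[of k] IVT2'[of f 2 c "z k"] continuous_f by auto
      then have "c \<in> f ` closed_segment (z k) 2"
        by (intro image_eqI[of _ _ x]) (auto simp: closed_segment_eq_real_ivl)
      with False show ?thesis
        by (simp add: S_Suc_if D_interval_step[of "Suc (S k)"] D c_mem_segment)
    qed
  qed
  show "D_interval f c (Suc (S k)) = closed_segment (z k) 2"
    using * c .
qed

lemma cutting_times_eq: "cutting_times f c = range S"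
proof
  show "cutting_times f c \<subseteq> range S"
  proof
    fix n
    assume "n \<in> cutting_times f c"
    then have "1 \<le> n" and "c \<in> D_interval f c n"
      by (auto simp: cutting_times_def)
    then show "n \<in> range S"
      by (cases rule: S_range_cases) (auto simp: D_Suc_S c_mem_segment)
  qed
  show "range S \<subseteq> cutting_times f c"
    using c_in_D_S S_ge_1 by (auto simp: cutting_times_def)
qed

lemma cutting_time_eq: "cutting_time f c = S"
  unfolding cutting_time_def cutting_times_eq by (rule enumerate_range_strict_mono[OF strict_mono_S])

lemma kneading_map:
  assumes "Q 0 = 0" and "\<And>k. int (Q (Suc k)) = carry k 1"
  shows "is_kneading_map_of Q f c"
  unfolding is_kneading_map_of_def cutting_time_eq
proof (intro conjI allI impI)
  show "infinite (cutting_times f c)"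
    unfolding cutting_times_eq using strict_mono_S
    by (intro range_inj_infinite strict_mono_imp_inj_on)
  fix k :: nat
  assume "1 \<le> k"
  then obtain j where k: "k = Suc j"
    by (cases k) auto
  \<comment> \<open>Hence \<open>S 1 = 2\<close>, so \<open>S (Q k) = 1 + Q k\<close> for both
    possible values 0 and 1 of \<open>Q k\<close>.\<close>
  have "carry 0 1 = 0"
    by (simp add: carry_def)
  then show "S k - S (k - 1) = S (Q k)"
    using carry_cases[of j 1] assms(2)[of j] S_Suc_if[of 0] S_Suc_if[of j] unfolding k by auto
qed (rule assms)

end

theorem proposition3p1:
  fixes \<gamma> :: real
  assumes "\<gamma> \<notin> \<rat>" and "0 < \<gamma>" and "\<gamma> < 1/2"
  shows "admissible_kneading_map (Q_rot \<gamma>)"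
proof -
  let ?\<omega> = "omega \<gamma>"
  \<comment> \<open>Inverting \<open>omega\<close> shows that a rational slope would make
    \<open>\<gamma>\<close> rational.\<close>
  have \<gamma>: "\<gamma> = ?\<omega> / (1 + ?\<omega>)"
    using assms by (simp add: omega_def field_simps)
  interpret irrational_slope ?\<omega>
  proof
    show "?\<omega> \<notin> \<rat>"
    proof
      assume "?\<omega> \<in> \<rat>"
      then have "?\<omega> / (1 + ?\<omega>) \<in> \<rat>" by simp
      with \<gamma> assms(1) show False by simp
    qed
    show "0 < ?\<omega>" "?\<omega> < 1"
      using assms by (auto simp: omega_def)
  qed
  have "int (Q_rot \<gamma> (Suc k)) = carry k 1" for k
    using int_Q_rot[of \<gamma> "Suc k"] assms by (simp add: carry_def)
  moreover have "Q_rot \<gamma> 0 = 0"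
    by (simp add: Q_rot_def)
  ultimately show ?thesis
    unfolding admissible_kneading_map_def
    using unimodal_f normalized_c nonperiodic_c kneading_map by blast
qed

end
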